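(* Let $\mathbb{P}$ be any complete product probability measure on $\mathbb{R}^{\mathbb{N}}$. For all Borel subsets $A,B\subset\mathbb{R}^{\mathbb{N}}$, the set $A\,\square\,B$ (the event that $A$ and $B$ occur for finite disjoint sets of reasons) is $\mathbb{P}$-measurable and $$\mathbb{P}(A\,\square\,B)\le \mathbb{P}(A)\,\mathbb{P}(B).$$ Moreover, for every integer $r\ge 2$ and all Borel subsets $A_1,\dots,A_r\subset\mathbb{R}^{\mathbb{N}}$, the set $\square_{i=1}^r A_i$ is $\mathbb{P}$-measurable and $$\mathbb{P}\Big(\square_{i=1}^r A_i\Big)\le\prod_{i=1}^r\mathbb{P}(A_i).$$
   Context: Let $S=\mathbb{R}$ and $\mathbb{N}=\{1,2,\dots\}$. For $\omega\in S^{\mathbb{N}}$ and $K\subset\mathbb{N}$, let $\mathrm{Cyl}(K,\omega)=\{\overline\omega\in S^{\mathbb{N}}:\overline\omega_i=\omega_i\text{ for all }i\in K\}$. For $A\subset S^{\mathbb{N}}$ let $[A]_K=\{\omega\in S^{\mathbb{N}}:\mathrm{Cyl}(K,\omega)\subset A\}$. For $A,B\subset S^{\mathbb{N}}$ define $A\,\square\,B=\bigcup[A]_J\cap[B]_K$, the union being over all pairs of finite disjoint subsets $J,K\subset\mathbb{N}$. For $A_1,\dots,A_r\subset S^{\mathbb{N}}$ define $\square_{i=1}^rA_i=\bigcup\bigcap_{i=1}^r[A_i]_{J_i}$, the union being over all $r$-tuples of finite, pairwise disjoint (possibly empty) subsets $J_1,\dots,J_r\subset\mathbb{N}$. A complete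 product probability measure on $\mathbb{R}^{\mathbb{N}}$ is the completion of a product $\prod_{i\in\mathbb{N}}\mu_i$ of (arbitrary, not necessarily equal) Borel probability measures $\mu_i$ on $\mathbb{R}$, defined initially on the Borel sigma-algebra of $\mathbb{R}^{\mathbb{N}}$ (product topology); "$\mathbb{P}$-measurable" means belonging to the completed sigma-algebra. *)

theory Defs
  imports "HOL-Probability.Probability"
begin

text \<open>Sequences are functions on the type \<^typ>\<open>nat\<close>; the index set starts at 0 instead of 1.\<close>

definition Cyl :: "nat set \<Rightarrow> (nat \<Rightarrow> 's) \<Rightarrow> (nat \<Rightarrow> 's) set" where
  "Cyl K \<omega> = {\<omega>'. \<forall>i\<in>K. \<omega>' i = \<omega> i}"

definition cyl_core :: "(nat \<Rightarrow> 's) set \<Rightarrow> nat set \<Rightarrow> (nat \<Rightarrow> 's) set" where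
  "cyl_core A K = {\<omega>. Cyl K \<omega> \<subseteq> A}"

definition disj_occ :: "(nat \<Rightarrow> 's) set \<Rightarrow> (nat \<Rightarrow> 's) set \<Rightarrow> (nat \<Rightarrow> 's) set" (infix "\<box>" 70) where
  "A \<box> B = \<Union>{cyl_core A J \<inter> cyl_core B K | J K. finite J \<and> finite K \<and> J \<inter> K = {}}"

definition disj_occ_fam :: "nat \<Rightarrow> (nat \<Rightarrow> (nat \<Rightarrow> 's) set) \<Rightarrow> (nat \<Rightarrow> 's) set" where
  "disj_occ_fam r A = \<Union>{\<Inter>i\<in>{1..r}. cyl_core (A i) (J i) | J.
      (\<forall>i\<in>{1..r}. finite (J i)) \<and> disjoint_family_on J {1..r}}"

end

theory Submission
  imports Defs
begin

text \<open>Let \<open>X\<close>, \<open>Y\<close> be independent with law \<open>P\<close>, and let \<open>X\<^sup>\<alpha>\<close> arise from \<open>X\<close> by exchanging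
  the coordinates in a finite set \<open>\<alpha> \<subseteq> {..<n}\<close> with those of \<open>Y\<close>. Each \<open>X\<^sup>\<alpha>\<close> has law \<open>P\<close> and is
  independent of the sequence made of the unused coordinates. Averaging over \<open>\<alpha>\<close> therefore reduces
  the inequality, without any discretisation of the marginals, to Reimer's theorem on the cube:
  disjoint occurrence of two events has at most as many points as the intersection of the first with
  the antipodal image of the second. That theorem is obtained by linear algebra: a family of integer
  tensors, one for each point of the disjoint occurrence, is linearly independent because it
  becomes triangular modulo 2, while its Gram matrix factors through the coordinates indexed by
  that intersection.

  Measurability holds because the complement of \<open>cyl_core A J\<close> is a projection of a Borel set,
  hence analytic, and analytic sets are measurable for the completion of every finite Borel measure.
  The inequality for \<open>r\<close> events follows by induction after replacing the disjoint occurrence of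
  the first \<open>r - 1\<close> events by a Borel set that contains it and has the same measure.\<close>

subsection \<open>Reimer's theorem on the cube\<close>

text \<open>Gaussian elimination without division: a homogeneous system with more unknowns than
  equations is reduced by cross-multiplying with a pivot, so the coefficients stay integers.\<close>

lemma integer_kernel_nontrivial:
  fixes p :: "'a \<Rightarrow> 'b \<Rightarrow> int"
  assumes "finite Z" "finite S" "card Z < card S"
  shows "\<exists>c. (\<exists>x\<in>S. c x \<noteq> 0) \<and> (\<forall>z\<in>Z. (\<Sum>x\<in>S. c x * p x z) = 0)"
  using assms
proof (induction Z arbitrary: S p rule: finite_induct)
  case empty
  then obtain x where "x \<in> S" by (metis card.empty card_gt_0_iff ex_in_conv)
  then show ?case by (intro exI[of _ "\<lambda>_. 1"]) auto
next
  case (insert z Z)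
  show ?case
  proof (cases "\<exists>x0\<in>S. p x0 z \<noteq> 0")
    case False
    obtain c where "\<exists>x\<in>S. c x \<noteq> 0" "\<forall>z\<in>Z. (\<Sum>x\<in>S. c x * p x z) = 0"
      using insert.IH[of S p] insert.hyps insert.prems by auto
    with False show ?thesis by (intro exI[of _ c]) auto
  next
    case True
    then obtain x0 where x0: "x0 \<in> S" "p x0 z \<noteq> 0" by blast
    define S' where "S' = S - {x0}"
    have S': "finite S'" "x0 \<notin> S'" "S = insert x0 S'" "card Z < card S'"
      using x0 insert.hyps insert.prems by (auto simp: S'_def)
    obtain c where c: "\<exists>x\<in>S'. c x \<noteq> 0"
      "\<And>w. w \<in> Z \<Longrightarrow> (\<Sum>x\<in>S'. c x * (p x0 z * p x w - p x z * p x0 w)) = 0"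
      using insert.IH[of S' "\<lambda>x w. p x0 z * p x w - p x z * p x0 w"] S' by blast
    \<comment> \<open>Scaling by the nonzero pivot \<open>p x0 z\<close> keeps the solution
      nontrivial, and the value at \<open>x0\<close> is chosen to satisfy the equation for
      \<open>z\<close>.\<close>
    define d where "d x = (if x = x0 then - (\<Sum>y\<in>S'. c y * p y z) else p x0 z * c x)" for x
    have d: "(\<Sum>x\<in>S. d x * p x w) =
        (\<Sum>x\<in>S'. c x * (p x0 z * p x w - p x z * p x0 w))" for w
    proof -
      have "(\<Sum>x\<in>S'. d x * p x w) = (\<Sum>x\<in>S'. p x0 z * c x * p x w)"
        using S'(2) by (intro sum.cong) (auto simp: d_def)
      then show ?thesis
        using S' by (simp add: d_def sum_subtractf sum_distrib_left sum_distrib_right algebra_simps)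
    qed
    show ?thesis
    proof (intro exI[of _ d] conjI ballI)
      from c(1) obtain x where "x \<in> S'" "c x \<noteq> 0" by blast
      then show "\<exists>x\<in>S. d x \<noteq> 0"
        using S' x0 by (intro bexI[of _ x]) (auto simp: d_def)
      show "(\<Sum>x\<in>S. d x * p x w) = 0" if "w \<in> insert z Z" for w
        using that c(2)[of w] unfolding d by (auto simp: algebra_simps)
    qed
  qed
qed

text \<open>The four vectors attached to a coordinate, indexed by the two Booleans
  \<open>i \<in> x\<close> and \<open>i \<in> J\<close>. Each class of equal first index is an orthogonal basis of
  the plane, and the two vectors of the second class coincide modulo 2.\<close>

definition wing_fst :: "bool \<Rightarrow> bool \<Rightarrow> int" where
  "wing_fst b j = (if b then if j then -1 else 1 else if j then 1 else 0)"

definition wing_snd :: "bool \<Rightarrow> bool \<Rightarrow> int" where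
  "wing_snd b j = (if b then 1 else if j then 0 else 1)"

text \<open>The tensor product over \<open>I\<close> of these plane vectors; \<open>z\<close>
  indexes the standard basis by the set of factors in which the second coordinate is taken.\<close>

definition wing :: "'a set \<Rightarrow> 'a set \<Rightarrow> 'a set \<Rightarrow> 'a set \<Rightarrow> int" where
  "wing I J x z = (\<Prod>i\<in>z. wing_snd (i \<in> x) (i \<in> J)) * (\<Prod>i\<in>I - z. wing_fst (i \<in> x) (i \<in> J))"

text \<open>Triangularity modulo 2: the relation is tested with a functional that is odd on the wing
  of \<open>x\<close> and even on the wing of every \<open>y\<close> not contained in
  \<open>x\<close>; the proper subsets of \<open>x\<close> are settled by induction.\<close>

lemma wing_dependence_even:
  fixes c :: "'a set \<Rightarrow> int"
  assumes I: "finite I" and S: "S \<subseteq> Pow I"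
    and dep: "\<And>z. z \<in> Pow I \<Longrightarrow> (\<Sum>x\<in>S. c x * wing I (J x) x z) = 0"
    and x: "x \<in> S"
  shows "even (c x)"
  using x
proof (induction "card x" arbitrary: x rule: less_induct)
  case less
  have fin: "finite S" using S I by (meson finite_Pow_iff finite_subset)
  have xI: "x \<subseteq> I" using less.prems S by auto
  have finx: "finite x" using xI I finite_subset by blast
  \<comment> \<open>The functional takes the first coordinate in the factors from \<open>x\<close>
    and the sum of both coordinates in the others.\<close>
  define \<psi> where "\<psi> y = (\<Sum>z\<in>Pow (I - x). wing I (J y) y z)" for y
  have \<psi>: "\<psi> y = (\<Prod>i\<in>I - x. wing_snd (i \<in> y) (i \<in> J y) + wing_fst (i \<in> y) (i \<in> J y)) *
      (\<Prod>i\<in>x. wing_fst (i \<in> y) (i \<in> J y))" for y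
  proof -
    have "wing I (J y) y z = (\<Prod>i\<in>z. wing_snd (i \<in> y) (i \<in> J y)) *
        (\<Prod>i\<in>I - x - z. wing_fst (i \<in> y) (i \<in> J y)) * (\<Prod>i\<in>x. wing_fst (i \<in> y) (i \<in> J y))"
      if "z \<in> Pow (I - x)" for z
    proof -
      have "I - z = (I - x - z) \<union> x" using that xI by auto
      then have "(\<Prod>i\<in>I - z. wing_fst (i \<in> y) (i \<in> J y)) =
        (\<Prod>i\<in>I - x - z. wing_fst (i \<in> y) (i \<in> J y)) * (\<Prod>i\<in>x. wing_fst (i \<in> y) (i \<in> J y))"
        using I finx by (subst prod.union_disjoint[symmetric]) auto
      then show ?thesis by (simp add: wing_def)
    qed
    then show ?thesis
      unfolding \<psi>_def using I by (subst prod_add) (simp_all add: sum_distrib_right)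
  qed
  have "(\<Sum>y\<in>S. c y * \<psi> y) = (\<Sum>z\<in>Pow (I - x). \<Sum>y\<in>S. c y * wing I (J y) y z)"
    unfolding \<psi>_def sum_distrib_left by (rule sum.swap)
  also have "\<dots> = 0" by (intro sum.neutral ballI dep) auto
  finally have "c x * \<psi> x = - (\<Sum>y\<in>S - {x}. c y * \<psi> y)"
    using fin less.prems by (simp add: sum.remove)
  moreover have "even (\<Sum>y\<in>S - {x}. c y * \<psi> y)"
  proof (rule dvd_sum)
    fix y assume y: "y \<in> S - {x}"
    show "even (c y * \<psi> y)"
    proof (cases "y \<subset> x")
      case True
      then show ?thesis using less.hyps[of y] y finx by (simp add: psubset_card_mono)
    next
      case False
      then obtain i where i: "i \<in> I - x" "i \<in> y" using y S by blast
      then have "even (wing_snd (i \<in> y) (i \<in> J y) + wing_fst (i \<in> y) (i \<in> J y))"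
        by (simp add: wing_fst_def wing_snd_def)
      then have "even (\<psi> y)"
        unfolding \<psi> using i(1) I by (subst even_mult_iff, subst even_prod_iff) blast+
      then show ?thesis by simp
    qed
  qed
  moreover have "odd (\<psi> x)"
    unfolding \<psi> by (simp add: wing_fst_def wing_snd_def even_prod_iff I finx)
  ultimately have "even (c x * \<psi> x)" "odd (\<psi> x)" by simp_all
  then show ?case by simp
qed

text \<open>Infinite descent: all coefficients of a relation are even, and halving them gives
  another relation, so every power of 2 divides each of them.\<close>

lemma wings_independent:
  fixes c :: "'a set \<Rightarrow> int"
  assumes I: "finite I" and S: "S \<subseteq> Pow I"
    and dep: "\<And>z. z \<in> Pow I \<Longrightarrow> (\<Sum>x\<in>S. c x * wing I (J x) x z) = 0"
    and x: "x \<in> S"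
  shows "c x = 0"
proof -
  have "\<forall>c. (\<forall>z\<in>Pow I. (\<Sum>x\<in>S. c x * wing I (J x) x z) = 0) \<longrightarrow> (\<forall>x\<in>S. 2 ^ k dvd c x)" for k :: nat
  proof (induction k)
    case (Suc k)
    show ?case
    proof (intro allI impI ballI)
      fix c :: "'a set \<Rightarrow> int" and x
      assume c: "\<forall>z\<in>Pow I. (\<Sum>x\<in>S. c x * wing I (J x) x z) = 0" and x: "x \<in> S"
      define d where "d x = c x div 2" for x
      have cd: "c x = 2 * d x" if "x \<in> S" for x
        using wing_dependence_even[OF I S, where c = c and J = J] c that by (simp add: d_def)
      have "2 * (\<Sum>x\<in>S. d x * wing I (J x) x z) = (\<Sum>x\<in>S. c x * wing I (J x) x z)" for z
        unfolding sum_distrib_left by (intro sum.cong) (auto simp: cd)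
      then have "2 * (\<Sum>x\<in>S. d x * wing I (J x) x z) = 0" if "z \<in> Pow I" for z
        using c that by metis
      then have "\<forall>z\<in>Pow I. (\<Sum>x\<in>S. d x * wing I (J x) x z) = 0" by simp
      with Suc.IH x have "2 ^ k dvd d x" by blast
      then show "2 ^ Suc k dvd c x" using cd[OF x] by simp
    qed
  qed simp
  then have "2 ^ k dvd c x" for k :: nat using dep x by blast
  show ?thesis
  proof (rule ccontr)
    assume "c x \<noteq> 0"
    then have "\<bar>2 ^ nat \<bar>c x\<bar>\<bar> \<le> \<bar>c x\<bar>"
      using \<open>2 ^ nat \<bar>c x\<bar> dvd c x\<close> dvd_imp_le_int by blast
    moreover have "int (nat \<bar>c x\<bar>) < 2 ^ nat \<bar>c x\<bar>"
      by (metis less_exp of_nat_less_iff of_nat_numeral of_nat_power)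
    ultimately show False by simp
  qed
qed

text \<open>In the basis \<open>(1,0), (-1,1)\<close> and its dual basis \<open>(1,1), (0,1)\<close>, the wing of \<open>x\<close>
  is supported on the subcube through \<open>x\<close> fixing \<open>J x\<close>, and in the other basis on the subcube
  through the antipode of \<open>x\<close> fixing the complement of \<open>J x\<close>. So the Gram matrix of the wings,
  which is nonsingular, factors through the intersection of the two unions of subcubes.\<close>

lemma reimer_butterfly:
  fixes J :: "'a set \<Rightarrow> 'a set"
  assumes I: "finite I" and S: "S \<subseteq> Pow I"
  shows "card S \<le> card {z \<in> Pow I. (\<exists>x\<in>S. \<forall>i\<in>I \<inter> J x. i \<in> z \<longleftrightarrow> i \<in> x) \<and>
    (\<exists>x\<in>S. \<forall>i\<in>I - J x. i \<in> z \<longleftrightarrow> i \<notin> x)}" (is "_ \<le> card ?Z")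
proof (rule ccontr)
  let ?a = "\<lambda>x i. wing_fst (i \<in> x) (i \<in> J x)" and ?b = "\<lambda>x i. wing_snd (i \<in> x) (i \<in> J x)"
  \<comment> \<open>Coefficients of the wing of \<open>x\<close> in the two dual product bases;
    \<open>z\<close> marks the factors in which the second basis vector is taken.\<close>
  define p where "p x z = (\<Prod>i\<in>z. ?b x i) * (\<Prod>i\<in>I - z. ?a x i + ?b x i)" for x z
  define q where "q x z = (\<Prod>i\<in>z. ?b x i - ?a x i) * (\<Prod>i\<in>I - z. ?a x i)" for x z
  have finS: "finite S" using S I by (meson finite_Pow_iff finite_subset)
  have fin: "finite (Pow I)" using I by simp
  assume "\<not> card S \<le> card ?Z"
  then obtain c where c: "\<exists>x\<in>S. c x \<noteq> 0" "\<And>z. z \<in> ?Z \<Longrightarrow> (\<Sum>x\<in>S. c x * p x z) = 0"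
    using integer_kernel_nontrivial[of ?Z S p] finS fin by auto
  have gram: "(\<Sum>z\<in>Pow I. p x z * q y z) = (\<Sum>z\<in>Pow I. wing I (J x) x z * wing I (J y) y z)" for x y
  proof -
    have "(\<Sum>z\<in>Pow I. p x z * q y z) =
        (\<Prod>i\<in>I. ?b x i * (?b y i - ?a y i) + (?a x i + ?b x i) * ?a y i)"
      using I by (subst prod_add) (auto simp: p_def q_def prod.distrib mult_ac)
    also have "\<dots> = (\<Prod>i\<in>I. ?b x i * ?b y i + ?a x i * ?a y i)"
      by (simp add: algebra_simps)
    also have "\<dots> = (\<Sum>z\<in>Pow I. wing I (J x) x z * wing I (J y) y z)"
      using I by (subst prod_add) (auto simp: wing_def prod.distrib mult_ac)
    finally show ?thesis .
  qed
  have finz: "finite z" if "z \<in> Pow I" for z using that I finite_subset by auto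
  have p0: "\<forall>i\<in>I \<inter> J x. i \<in> z \<longleftrightarrow> i \<in> x" if "p x z \<noteq> 0" "z \<in> Pow I" for x z
    using that finz[OF that(2)] I
    by (auto simp: p_def wing_fst_def wing_snd_def split: if_splits)
  have q0: "\<forall>i\<in>I - J x. i \<in> z \<longleftrightarrow> i \<notin> x" if "q x z \<noteq> 0" "z \<in> Pow I" for x z
    using that finz[OF that(2)] I
    by (auto simp: q_def wing_fst_def wing_snd_def split: if_splits)
  \<comment> \<open>The squared norm of this combination, rewritten through \<open>p\<close> and
    \<open>q\<close>, vanishes: inside \<open>?Z\<close> by the choice of \<open>c\<close>, outside
    because \<open>p\<close> or \<open>q\<close> is zero at \<open>z\<close> for all members of
    \<open>S\<close>.\<close>
  define w where "w z = (\<Sum>x\<in>S. c x * wing I (J x) x z)" for z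
  have "(\<Sum>z\<in>Pow I. w z * w z) =
      (\<Sum>z\<in>Pow I. \<Sum>x\<in>S. \<Sum>y\<in>S. c x * c y * (wing I (J x) x z * wing I (J y) y z))"
    by (simp add: w_def sum_product mult_ac)
  also have "\<dots> = (\<Sum>x\<in>S. \<Sum>y\<in>S. c x * c y * (\<Sum>z\<in>Pow I. wing I (J x) x z * wing I (J y) y z))"
    by (simp add: sum.swap[of _ _ "Pow I"] sum_distrib_left)
  also have "\<dots> = (\<Sum>z\<in>Pow I. (\<Sum>x\<in>S. c x * p x z) * (\<Sum>y\<in>S. c y * q y z))"
    unfolding gram[symmetric] sum_product
    by (simp add: sum.swap[of _ _ "Pow I"] sum_distrib_left mult_ac)
  also have "\<dots> = 0"
  proof (intro sum.neutral ballI)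
    fix z assume z: "z \<in> Pow I"
    show "(\<Sum>x\<in>S. c x * p x z) * (\<Sum>y\<in>S. c y * q y z) = 0"
    proof (cases "z \<in> ?Z")
      case False
      with z consider "\<not> (\<exists>x\<in>S. \<forall>i\<in>I \<inter> J x. i \<in> z \<longleftrightarrow> i \<in> x)"
        | "\<not> (\<exists>x\<in>S. \<forall>i\<in>I - J x. i \<in> z \<longleftrightarrow> i \<notin> x)"
        by blast
      then show ?thesis
      proof cases
        case 1
        then have "p x z = 0" if "x \<in> S" for x using p0[OF _ z] that by meson
        then show ?thesis by simp
      next
        case 2
        then have "q x z = 0" if "x \<in> S" for x using q0[OF _ z] that by meson
        then show ?thesis by simp
      qed
    qed (simp add: c)
  qed
  finally have "\<forall>z\<in>Pow I. w z * w z = 0" using fin by (subst (asm) sum_nonneg_eq_0_iff) auto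
  then have "c x = 0" if "x \<in> S" for x
    using wings_independent[OF I S, of c J] that by (simp add: w_def)
  with c(1) show False by blast
qed

subsection \<open>Universal measurability of analytic sets\<close>

lemma tendsto_fun_iff:
  fixes f :: "nat \<Rightarrow> 'i \<Rightarrow> 'b::topological_space"
  shows "f \<longlonglongrightarrow> l \<longleftrightarrow> (\<forall>i. (\<lambda>n. f n i) \<longlonglongrightarrow> l i)"
  using limitin_componentwise[of "\<lambda>_. euclidean" UNIV f l sequentially]
  by (simp add: euclidean_product_topology)

lemma compact_coordinate_bounded:
  "compact {y :: 'i \<Rightarrow> real. \<forall>i. \<bar>y i\<bar> \<le> k i}"
proof -
  have "{y :: 'i \<Rightarrow> real. \<forall>i. \<bar>y i\<bar> \<le> k i} = (\<Pi>\<^sub>E i\<in>UNIV. {- k i..k i})"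
    by (simp add: set_eq_iff PiE_UNIV_domain Pi_iff abs_le_iff) (metis minus_le_iff)
  moreover have "compactin (product_topology (\<lambda>_. euclidean) UNIV) (\<Pi>\<^sub>E i\<in>(UNIV :: 'i set). {- k i..k i :: real})"
    by (simp add: compactin_PiE)
  ultimately show ?thesis
    by (simp add: euclidean_product_topology)
qed

text \<open>Points of \<open>G n\<close> projecting close to \<open>x\<close> have their first
  \<open>n\<close> fibre coordinates bounded, so compactness of products of intervals yields a
  convergent subsequence; its limit lies above \<open>x\<close>, and in \<open>C\<close> because
  \<open>C\<close> is closed.\<close>

lemma Inter_closure_projection_subset:
  fixes C :: "('a::metric_space \<times> (nat \<Rightarrow> real)) set"
  assumes C: "closed C" and G: "\<And>n. G n \<subseteq> C"
    and k: "\<And>n x y i. (x, y) \<in> G n \<Longrightarrow> i < n \<Longrightarrow> \<bar>y i\<bar> \<le> k i"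
  shows "(\<Inter>n. closure (fst ` G n)) \<subseteq> fst ` C"
proof
  fix x assume x: "x \<in> (\<Inter>n. closure (fst ` G n))"
  have "\<exists>a b. (a, b) \<in> G n \<and> dist a x < inverse (real (Suc n))" for n
  proof -
    have "x \<in> closure (fst ` G n)" using x by blast
    then have "\<exists>a\<in>fst ` G n. dist a x < inverse (real (Suc n))"
      by (simp add: closure_approachable)
    then show ?thesis by auto
  qed
  then obtain a b where ab: "\<And>n. (a n, b n) \<in> G n" "\<And>n. dist (a n) x < inverse (real (Suc n))"
    by metis
  \<comment> \<open>Zeroing the coordinates from \<open>n\<close> on puts the sequence into a
    compact set; each fixed coordinate is affected for finitely many \<open>n\<close> only, so the
    limits agree.\<close>
  define b' where "b' n = (\<lambda>i. if i < n then b n i else 0)" for n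
  have "b' n \<in> {y. \<forall>i. \<bar>y i\<bar> \<le> \<bar>k i\<bar>}" for n
    using k[OF ab(1)] by (force simp: b'_def)
  then obtain l s where s: "strict_mono s" and l: "(b' \<circ> s) \<longlonglongrightarrow> l"
    using compact_coordinate_bounded[of "\<lambda>i. \<bar>k i\<bar>"] unfolding compact_eq_seq_compact_metric seq_compact_def
    by meson
  have "(b \<circ> s) \<longlonglongrightarrow> l"
    unfolding tendsto_fun_iff
  proof
    fix i
    have "eventually (\<lambda>n. (b' \<circ> s) n i = (b \<circ> s) n i) sequentially"
      using eventually_gt_at_top[of i]
    proof eventually_elim
      case (elim n)
      then show ?case using seq_suble[OF s, of n] by (simp add: b'_def)
    qed
    moreover have "(\<lambda>n. (b' \<circ> s) n i) \<longlonglongrightarrow> l i" using l by (simp add: tendsto_fun_iff)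
    ultimately show "(\<lambda>n. (b \<circ> s) n i) \<longlonglongrightarrow> l i" by (rule Lim_transform_eventually[rotated])
  qed
  moreover have "a \<longlonglongrightarrow> x"
  proof (rule metric_LIMSEQ_I)
    fix r :: real assume "r > 0"
    then obtain N where N: "inverse (real (Suc N)) < r" using reals_Archimedean by blast
    have "dist (a n) x < r" if "n \<ge> N" for n
    proof -
      have "inverse (real (Suc n)) \<le> inverse (real (Suc N))" using that by (simp add: field_simps)
      then show ?thesis using ab(2)[of n] N by linarith
    qed
    then show "\<exists>N. \<forall>n\<ge>N. dist (a n) x < r" by blast
  qed
  then have "(a \<circ> s) \<longlonglongrightarrow> x" using LIMSEQ_subseq_LIMSEQ s by blast
  ultimately have lim: "(\<lambda>n. (a (s n), b (s n))) \<longlonglongrightarrow> (x, l)"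
    unfolding comp_def by (rule tendsto_Pair[rotated])
  have mem: "(a (s n), b (s n)) \<in> C" for n using ab(1) G by auto
  have "(x, l) \<in> C" by (rule closed_sequentially[OF C mem lim])
  then show "x \<in> fst ` C" by force
qed

text \<open>The fibre coordinates are bounded one after the other, using continuity from below of the
  outer measure.\<close>

lemma projection_inner_approx:
  fixes C :: "('a::metric_space \<times> (nat \<Rightarrow> real)) set"
  assumes M: "finite_measure M" "sets M = sets borel" and C: "closed C"
    and c: "c < outer_measure_of M (fst ` C)"
  shows "\<exists>E\<in>sets M. E \<subseteq> fst ` C \<and> c \<le> emeasure M E"
proof -
  have sp: "space M = UNIV" using M(2) sets_eq_imp_space_eq[of M borel] by simp
  have "\<exists>G. \<forall>n. (G n \<subseteq> C \<and> c < outer_measure_of M (fst ` G n)) \<and>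
      (\<exists>m::nat. G (Suc n) = G n \<inter> {(x, y). \<bar>y n\<bar> \<le> real m})"
  proof (rule dependent_nat_choice)
    show "\<exists>G. G \<subseteq> C \<and> c < outer_measure_of M (fst ` G)" using c by blast
    fix G n assume G: "G \<subseteq> C \<and> c < outer_measure_of M (fst ` G)"
    define H where "H m = G \<inter> {(x, y). \<bar>y n\<bar> \<le> real m}" for m :: nat
    have "G = (\<Union>m. H m)"
      by (auto simp: H_def real_arch_simple)
    then have "fst ` G = (\<Union>m. fst ` H m)" by blast
    moreover have "incseq (\<lambda>m. fst ` H m)"
      by (intro incseq_SucI image_mono) (force simp: H_def)
    ultimately have "(SUP m. outer_measure_of M (fst ` H m)) = outer_measure_of M (fst ` G)"
      using SUP_outer_measure_of_incseq[of "\<lambda>m. fst ` H m" M] by (simp add: sp)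
    then obtain m where "c < outer_measure_of M (fst ` H m)"
      using G by (metis less_SUP_iff)
    then show "\<exists>G'. (G' \<subseteq> C \<and> c < outer_measure_of M (fst ` G')) \<and>
        (\<exists>m::nat. G' = G \<inter> {(x, y). \<bar>y n\<bar> \<le> real m})"
      using G unfolding H_def by (intro exI[of _ "G \<inter> {(x, y). \<bar>y n\<bar> \<le> real m}"]) auto
  qed
  then obtain G m where G: "\<And>n. G n \<subseteq> C" "\<And>n. c < outer_measure_of M (fst ` G n)"
      "\<And>n. G (Suc n) = G n \<inter> {(x, y). \<bar>y n\<bar> \<le> real (m n :: nat)}"
    by metis
  have dec: "G j \<subseteq> G n" if "n \<le> j" for n j
    using that by (rule lift_Suc_antimono_le[rotated]) (use G(3) in auto)
  have "\<bar>y i\<bar> \<le> real (m i)" if "(x, y) \<in> G n" "i < n" for n x y i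
    using dec[of "Suc i" n] G(3)[of i] that by auto
  then have sub: "(\<Inter>n. closure (fst ` G n)) \<subseteq> fst ` C"
    by (rule Inter_closure_projection_subset[OF C G(1)])
  \<comment> \<open>The projections need not be measurable, so the bound is moved to their closures,
    where continuity from above applies.\<close>
  have meas: "closure (fst ` G n) \<in> sets M" for n using M(2) by auto
  have "c \<le> emeasure M (closure (fst ` G n))" for n
    using G(2)[of n] outer_measure_of_mono[OF closure_subset, of M "fst ` G n"]
      outer_measure_of_eq[OF meas, of n] by auto
  then have "c \<le> (INF n. emeasure M (closure (fst ` G n)))" by (rule INF_greatest)
  also have "\<dots> = emeasure M (\<Inter>n. closure (fst ` G n))"
  proof (rule INF_emeasure_decseq)
    show "decseq (\<lambda>n. closure (fst ` G n))"
      unfolding decseq_def by (intro allI impI closure_mono image_mono dec)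
    show "emeasure M (closure (fst ` G n)) \<noteq> \<infinity>" for n
      using M(1) finite_measure.emeasure_finite by auto
  qed (use meas in auto)
  finally show ?thesis
    using sub meas by (intro bexI[of _ "\<Inter>n. closure (fst ` G n)"]) auto
qed

text \<open>The projection lies between a countable union of Borel inner approximations and a Borel
  hull of the same measure, so it differs from either by a subset of a null set.\<close>

lemma projection_in_completion:
  fixes C :: "('a::metric_space \<times> (nat \<Rightarrow> real)) set"
  assumes M: "finite_measure M" "sets M = sets borel" and C: "closed C"
  shows "fst ` C \<in> sets (completion M)"
proof -
  interpret finite_measure M by fact
  let ?A = "fst ` C"
  have sp: "space M = UNIV" using M(2) sets_eq_imp_space_eq[of M borel] by simp
  obtain F where F: "F \<in> sets M" "?A \<subseteq> F" "outer_measure_of M ?A = emeasure M F"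
    using outer_measure_of_attain[of ?A M] sp by auto
  have "\<exists>E\<in>sets M. E \<subseteq> ?A \<and> measure M F - inverse (real (Suc n)) \<le> measure M E" for n
  \<comment> \<open>\<open>ennreal\<close> truncates negative reals to 0, so the strict inequality
    required for the approximation could fail when \<open>F\<close> is null; in the negative case
    the empty set suffices.\<close>
  proof (cases "measure M F - inverse (real (Suc n)) < 0")
    case True
    then show ?thesis by (intro bexI[of _ "{}"]) auto
  next
    case False
    have "ennreal (measure M F - inverse (real (Suc n))) < emeasure M F"
      using False by (subst emeasure_eq_measure, subst ennreal_less_iff) (auto simp: field_simps)
    then obtain E where E: "E \<in> sets M" "E \<subseteq> ?A" "ennreal (measure M F - inverse (real (Suc n))) \<le> emeasure M E"
      using projection_inner_approx[OF M C] F(3) by metis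
    then show ?thesis
      by (intro bexI[of _ E]) (auto simp: emeasure_eq_measure ennreal_le_iff)
  qed
  then obtain E where E: "\<And>n. E n \<in> sets M" "\<And>n. E n \<subseteq> ?A"
      "\<And>n. measure M F - inverse (real (Suc n)) \<le> measure M (E n)"
    by metis
  let ?E = "\<Union>n. E n"
  have meas: "?E \<in> sets M" using E by auto
  have sub: "?E \<subseteq> ?A" "?E \<subseteq> F" using E(2) F(2) by blast+
  have le: "measure M F - inverse (real (Suc n)) \<le> measure M ?E" for n
    using E(3)[of n] finite_measure_mono[OF UN_upper[of n UNIV E] meas] by simp
  have "measure M F \<le> measure M ?E"
  proof (rule field_le_epsilon)
    fix e :: real assume "e > 0"
    then obtain n where "inverse (real (Suc n)) < e" using reals_Archimedean by blast
    then show "measure M F \<le> measure M ?E + e" using le[of n] by linarith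
  qed
  then have "measure M (F - ?E) = 0"
    using finite_measure_Diff[OF F(1) meas sub(2)] finite_measure_mono[OF sub(2) F(1)] by linarith
  then have "F - ?E \<in> null_sets M"
    using F(1) meas by (simp add: null_sets_def emeasure_eq_measure)
  then show ?thesis
    by (intro sets_completionI[of _ ?E "?A - ?E" "F - ?E"]) (use F sub meas in auto)
qed

text \<open>Suslin sets, with real sequences in place of Baire space as parameters; countably many
  parameters can be coded into one by reindexing.\<close>

definition analytic_set :: "'a::metric_space set \<Rightarrow> bool" where
  "analytic_set A \<longleftrightarrow> (\<exists>C :: ('a \<times> (nat \<Rightarrow> real)) set. closed C \<and> A = fst ` C)"

section \<open>Closure properties of analytic sets\<close>

lemma continuous_on_reindex: "continuous_on S (\<lambda>w :: nat \<Rightarrow> real. \<lambda>i. w (g i))"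
  by (intro continuous_on_coordinatewise_then_product)
    (rule continuous_on_subset[OF continuous_on_product_coordinates], simp)

lemma continuous_on_reindex_snd:
  "continuous_on S (\<lambda>p :: 'a::topological_space \<times> (nat \<Rightarrow> real). \<lambda>i. snd p (g i))"
  by (rule continuous_on_compose2[OF continuous_on_reindex[of UNIV g] continuous_on_snd]) auto

lemma continuous_on_coordinate_snd:
  "continuous_on S (\<lambda>p :: 'a::topological_space \<times> (nat \<Rightarrow> real). snd p i)"
  by (rule continuous_on_compose2[OF continuous_on_product_coordinates continuous_on_snd]) auto

lemma analytic_closed: "closed A \<Longrightarrow> analytic_set A"
  unfolding analytic_set_def
  by (intro exI[of _ "A \<times> UNIV"]) (auto simp: closed_Times)

text \<open>An open set is the projection of the closed graph of the inverse distance to its complement.\<close>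

lemma analytic_open:
  fixes A :: "'a::metric_space set"
  assumes "open A"
  shows "analytic_set A"
proof (cases "A = UNIV")
  case False
  define C where "C = {p :: 'a \<times> (nat \<Rightarrow> real). snd p 0 * infdist (fst p) (- A) = 1}"
  have "closed C"
    unfolding C_def
    by (intro closed_Collect_eq continuous_intros continuous_on_coordinate_snd)
  moreover have "A = fst ` C"
  proof (intro equalityI subsetI)
    fix x assume "x \<in> A"
    then have "infdist x (- A) \<noteq> 0"
      using in_closed_iff_infdist_zero[of "- A" x] assms False by auto
    then have "(x, \<lambda>_. 1 / infdist x (- A)) \<in> C" by (simp add: C_def)
    then show "x \<in> fst ` C" by force
  next
    fix x assume "x \<in> fst ` C"
    then have "infdist x (- A) \<noteq> 0" by (auto simp: C_def)
    then show "x \<in> A" using infdist_zero[of x "- A"] by blast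
  qed
  ultimately show ?thesis unfolding analytic_set_def by blast
qed (simp add: analytic_closed)

text \<open>Coordinate 0 of the parameter codes the index of a set containing the point; the later
  coordinates are the parameter for that set.\<close>

lemma analytic_UN:
  fixes A :: "nat \<Rightarrow> 'a::metric_space set"
  assumes "\<And>n. analytic_set (A n)"
  shows "analytic_set (\<Union>n. A n)"
proof -
  obtain C where C: "\<And>n. closed (C n)" "\<And>n. A n = fst ` (C n :: ('a \<times> (nat \<Rightarrow> real)) set)"
    using assms unfolding analytic_set_def by metis
  \<comment> \<open>That coordinate 0 differs from \<open>n\<close> is expressed as distance at
    least 1, which is equivalent for natural numbers and keeps the condition closed.\<close>
  define D where "D = (\<lambda>p :: 'a \<times> (nat \<Rightarrow> real). snd p 0) -` \<nat> \<inter>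
    (\<Inter>n. {p. 1 \<le> \<bar>snd p 0 - real n\<bar>} \<union> (\<lambda>p. (fst p, \<lambda>i. snd p (Suc i))) -` C n)"
  have "closed ((\<lambda>p :: 'a \<times> (nat \<Rightarrow> real). snd p 0) -` \<nat>)"
    by (intro closed_vimage closed_Nats continuous_on_coordinate_snd)
  moreover have "closed ((\<lambda>p :: 'a \<times> (nat \<Rightarrow> real). (fst p, \<lambda>i. snd p (Suc i))) -` C n)" for n
    using C(1) by (intro closed_vimage continuous_intros continuous_on_reindex_snd)
  moreover have "closed {p :: 'a \<times> (nat \<Rightarrow> real). 1 \<le> \<bar>snd p 0 - real n\<bar>}" for n
    by (intro closed_Collect_le continuous_intros continuous_on_coordinate_snd)
  ultimately have "closed D"
    unfolding D_def by (intro closed_Int closed_INT closed_Un ballI)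
  moreover have "(\<Union>n. A n) = fst ` D"
  proof (intro equalityI subsetI)
    fix x assume "x \<in> (\<Union>n. A n)"
    then obtain n y where ny: "(x, y) \<in> C n" using C(2) by force
    have "(x, case_nat (real n) y) \<in> D"
    proof -
      have "1 \<le> \<bar>real n - real m\<bar>" if "m \<noteq> n" for m using that by linarith
      then show ?thesis using ny by (force simp: D_def)
    qed
    then show "x \<in> fst ` D" by force
  next
    fix x assume "x \<in> fst ` D"
    then obtain w where w: "(x, w) \<in> D" by auto
    then obtain n where "w 0 = real n" by (auto simp: D_def elim: Nats_cases)
    with w have "(x, \<lambda>i. w (Suc i)) \<in> C n"
      unfolding D_def by (auto dest!: spec[of _ n])
    then show "x \<in> (\<Union>n. A n)" using C(2) by force
  qed
  ultimately show ?thesis unfolding analytic_set_def by blast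
qed

text \<open>One real sequence codes a whole sequence of parameters through the pairing
  function.\<close>

lemma analytic_INT:
  fixes A :: "nat \<Rightarrow> 'a::metric_space set"
  assumes "\<And>n. analytic_set (A n)"
  shows "analytic_set (\<Inter>n. A n)"
proof -
  obtain C where C: "\<And>n. closed (C n)" "\<And>n. A n = fst ` (C n :: ('a \<times> (nat \<Rightarrow> real)) set)"
    using assms unfolding analytic_set_def by metis
  define D where "D = (\<Inter>n. (\<lambda>p :: 'a \<times> (nat \<Rightarrow> real). (fst p, \<lambda>i. snd p (prod_encode (n, i)))) -` C n)"
  have "closed D"
    unfolding D_def using C(1)
    by (intro closed_INT ballI closed_vimage continuous_intros continuous_on_reindex_snd)
  moreover have "(\<Inter>n. A n) = fst ` D"
  proof (intro equalityI subsetI)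
    fix x assume "x \<in> (\<Inter>n. A n)"
    then have "\<forall>n. \<exists>y. (x, y) \<in> C n" using C(2) by force
    then obtain y where y: "\<And>n. (x, y n) \<in> C n" by metis
    have "(x, \<lambda>k. case prod_decode k of (n, i) \<Rightarrow> y n i) \<in> D" using y by (auto simp: D_def)
    then show "x \<in> fst ` D" by force
  next
    fix x assume "x \<in> fst ` D"
    then show "x \<in> (\<Inter>n. A n)" using C(2) by (force simp: D_def)
  qed
  ultimately show ?thesis unfolding analytic_set_def by blast
qed

text \<open>Analytic sets need not be closed under complement, so the induction carries the set and
  its complement together.\<close>

lemma analytic_borel:
  fixes A :: "'a::metric_space set"
  assumes "A \<in> sets borel"
  shows "analytic_set A"
proof -
  have "A \<in> sigma_sets UNIV {S. open S}" using assms by (simp add: sets_borel)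
  then have "analytic_set A \<and> analytic_set (UNIV - A)"
  proof induction
    case (Basic S)
    then show ?case by (simp add: analytic_open analytic_closed Compl_eq_Diff_UNIV[symmetric] closed_Compl)
  next
    case Empty
    then show ?case by (simp add: analytic_closed)
  next
    case (Compl S)
    then show ?case by (simp add: double_diff)
  next
    case (Union S)
    have "analytic_set (\<Inter>i. UNIV - S i)" using Union by (intro analytic_INT) blast
    moreover have "UNIV - (\<Union>i. S i) = (\<Inter>i. UNIV - S i)" by auto
    ultimately show ?case using Union by (metis analytic_UN)
  qed
  then show ?thesis ..
qed

text \<open>The quantified \<open>y\<close> and the parameter for \<open>B\<close> are interleaved
  on the even and odd coordinates of one sequence.\<close>

lemma analytic_continuous_projection:
  fixes h :: "'a::metric_space \<times> (nat \<Rightarrow> real) \<Rightarrow> 'b::metric_space"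
  assumes B: "analytic_set B" and h: "continuous_on UNIV h"
  shows "analytic_set {x. \<exists>y. h (x, y) \<in> B}"
proof -
  obtain C :: "('b \<times> (nat \<Rightarrow> real)) set" where C: "closed C" "B = fst ` C"
    using B unfolding analytic_set_def by blast
  define D where "D = (\<lambda>p. (h (fst p, \<lambda>i. snd p (2 * i)), \<lambda>i. snd p (Suc (2 * i)))) -` C"
  have "closed D"
    unfolding D_def
    by (intro closed_vimage C(1) continuous_on_Pair continuous_on_reindex_snd
        continuous_on_compose2[OF h] continuous_on_fst continuous_on_id subset_UNIV)
  moreover have "{x. \<exists>y. h (x, y) \<in> B} = fst ` D"
  proof (intro equalityI subsetI)
    fix x assume "x \<in> {x. \<exists>y. h (x, y) \<in> B}"
    then obtain y z where yz: "(h (x, y), z) \<in> C" using C(2) by force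
    have "(x, \<lambda>k. if even k then y (k div 2) else z (k div 2)) \<in> D" using yz by (simp add: D_def)
    then show "x \<in> fst ` D" by force
  next
    fix x assume "x \<in> fst ` D"
    then show "x \<in> {x. \<exists>y. h (x, y) \<in> B}" using C(2) by (force simp: D_def)
  qed
  ultimately show ?thesis unfolding analytic_set_def by blast
qed

lemma cyl_core_in_completion:
  fixes M :: "(nat \<Rightarrow> real) measure"
  assumes M: "finite_measure M" "sets M = sets borel" and A: "A \<in> sets borel"
  shows "cyl_core A J \<in> sets (completion M)"
proof -
  \<comment> \<open>As \<open>y\<close> varies, \<open>h (x, y)\<close> runs through exactly
    \<open>Cyl J x\<close>, so the complement of the core is given by one existential quantifier
    over real sequences.\<close>
  define h where "h = (\<lambda>(x, y) i. if i \<in> J then x i else y i :: real)"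
  have "continuous_on UNIV h"
  proof (rule continuous_on_coordinatewise_then_product)
    fix i
    have "continuous_on UNIV (\<lambda>p :: (nat \<Rightarrow> real) \<times> (nat \<Rightarrow> real). if i \<in> J then fst p i else snd p i)"
      using continuous_on_compose2[OF continuous_on_product_coordinates[of i] continuous_on_fst[OF continuous_on_id]]
      by (cases "i \<in> J") (auto intro: continuous_on_coordinate_snd)
    then show "continuous_on UNIV (\<lambda>p. h p i)" by (simp add: h_def case_prod_beta)
  qed
  moreover have "analytic_set (- A)" using A by (intro analytic_borel) auto
  ultimately have "analytic_set {x. \<exists>y. h (x, y) \<in> - A}" by (intro analytic_continuous_projection)
  then have "{x. \<exists>y. h (x, y) \<in> - A} \<in> sets (completion M)"
    unfolding analytic_set_def using projection_in_completion[OF M] by auto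
  moreover have "cyl_core A J = space (completion M) - {x. \<exists>y. h (x, y) \<in> - A}"
  proof -
    have "Cyl J x = range (\<lambda>y. h (x, y))" for x
    proof (intro equalityI subsetI)
      fix z assume "z \<in> Cyl J x"
      then have "z = h (x, z)" by (auto simp: Cyl_def h_def fun_eq_iff)
      then show "z \<in> range (\<lambda>y. h (x, y))" by blast
    qed (auto simp: Cyl_def h_def)
    then have "Cyl J x \<subseteq> A \<longleftrightarrow> (\<forall>y. h (x, y) \<in> A)" for x by auto
    then show ?thesis
      using M(2) sets_eq_imp_space_eq[of M borel] by (auto simp: cyl_core_def)
  qed
  ultimately show ?thesis by (metis sets.compl_sets)
qed

subsection \<open>Disjoint occurrence in product spaces\<close>

text \<open>Two independent copies of a sequence are stored in one family indexed by \<open>'i \<times> bool\<close>;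
  \<open>select \<alpha>\<close> and \<open>select (- \<alpha>)\<close> then use disjoint sets of coordinates.\<close>

definition select :: "'i set \<Rightarrow> ('i \<times> bool \<Rightarrow> 's) \<Rightarrow> 'i \<Rightarrow> 's" where
  "select \<alpha> x = (\<lambda>i. x (i, i \<in> \<alpha>))"

text \<open>Truncation to reasons among the first \<open>n\<close> indices; the events themselves
  may still depend on all coordinates.\<close>

definition disj_occ_upto :: "nat \<Rightarrow> (nat \<Rightarrow> 's) set \<Rightarrow> (nat \<Rightarrow> 's) set \<Rightarrow> (nat \<Rightarrow> 's) set" where
  "disj_occ_upto n A B =
    (\<Union>J\<in>Pow {..<n}. \<Union>K\<in>Pow ({..<n} - J). cyl_core A J \<inter> cyl_core B K)"

text \<open>For fixed \<open>x\<close> the sets \<open>\<alpha>\<close> are the points of a cube. A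
  point \<open>z\<close> agreeing with \<open>\<alpha>\<close> on the reasons for \<open>A\<close>
  puts \<open>select z x\<close> into \<open>A\<close>; one opposite to \<open>\<alpha>\<close> off
  them makes \<open>select (- z) x\<close> agree with \<open>select \<alpha> x\<close> on the
  reasons for \<open>B\<close>.\<close>

lemma card_select_disj_occ_upto:
  "card {\<alpha> \<in> Pow {..<n}. select \<alpha> x \<in> disj_occ_upto n A B} \<le>
   card {\<alpha> \<in> Pow {..<n}. select \<alpha> x \<in> A \<and> select (- \<alpha>) x \<in> B}"
proof -
  let ?S = "{\<alpha> \<in> Pow {..<n}. select \<alpha> x \<in> disj_occ_upto n A B}"
  have "\<forall>\<alpha>\<in>?S. \<exists>J K. J \<subseteq> {..<n} \<and> K \<subseteq> {..<n} - J \<and>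
      Cyl J (select \<alpha> x) \<subseteq> A \<and> Cyl K (select \<alpha> x) \<subseteq> B"
    unfolding disj_occ_upto_def cyl_core_def by blast
  then obtain J K where JK: "\<forall>\<alpha>\<in>?S. J \<alpha> \<subseteq> {..<n} \<and> K \<alpha> \<subseteq> {..<n} - J \<alpha> \<and>
      Cyl (J \<alpha>) (select \<alpha> x) \<subseteq> A \<and> Cyl (K \<alpha>) (select \<alpha> x) \<subseteq> B"
    unfolding bchoice_iff by (elim exE) (rule that)
  have "card ?S \<le> card {z \<in> Pow {..<n}. (\<exists>\<alpha>\<in>?S. \<forall>i\<in>{..<n} \<inter> J \<alpha>. i \<in> z \<longleftrightarrow> i \<in> \<alpha>) \<and>
      (\<exists>\<alpha>\<in>?S. \<forall>i\<in>{..<n} - J \<alpha>. i \<in> z \<longleftrightarrow> i \<notin> \<alpha>)}"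
    by (rule reimer_butterfly) auto
  also have "\<dots> \<le> card {\<alpha> \<in> Pow {..<n}. select \<alpha> x \<in> A \<and> select (- \<alpha>) x \<in> B}"
  proof (rule card_mono)
    have "select z x \<in> A" if "\<alpha> \<in> ?S" "\<forall>i\<in>{..<n} \<inter> J \<alpha>. i \<in> z \<longleftrightarrow> i \<in> \<alpha>" for z \<alpha>
    proof -
      have "select z x \<in> Cyl (J \<alpha>) (select \<alpha> x)"
        using JK[rule_format, OF that(1)] that(2) by (auto simp: Cyl_def select_def subset_iff)
      then show ?thesis using JK[rule_format, OF that(1)] by blast
    qed
    moreover have "select (- z) x \<in> B" if "\<alpha> \<in> ?S" "\<forall>i\<in>{..<n} - J \<alpha>. i \<in> z \<longleftrightarrow> i \<notin> \<alpha>" for z \<alpha>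
    proof -
      have "select (- z) x \<in> Cyl (K \<alpha>) (select \<alpha> x)"
        using JK[rule_format, OF that(1)] that(2) by (auto simp: Cyl_def select_def subset_iff)
      then show ?thesis using JK[rule_format, OF that(1)] by blast
    qed
    ultimately show "{z \<in> Pow {..<n}. (\<exists>\<alpha>\<in>?S. \<forall>i\<in>{..<n} \<inter> J \<alpha>. i \<in> z \<longleftrightarrow> i \<in> \<alpha>) \<and>
      (\<exists>\<alpha>\<in>?S. \<forall>i\<in>{..<n} - J \<alpha>. i \<in> z \<longleftrightarrow> i \<notin> \<alpha>)}
      \<subseteq> {\<alpha> \<in> Pow {..<n}. select \<alpha> x \<in> A \<and> select (- \<alpha>) x \<in> B}"
      by blast
  qed simp
  finally show ?thesis .
qed

section \<open>Exhaustion by finite sets of reasons\<close>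

lemma disj_occ_eq_UN_upto: "A \<box> B = (\<Union>n. disj_occ_upto n A B)"
proof (intro equalityI subsetI)
  fix \<omega> assume "\<omega> \<in> A \<box> B"
  then obtain J K where JK: "finite J" "finite K" "J \<inter> K = {}" "\<omega> \<in> cyl_core A J \<inter> cyl_core B K"
    unfolding disj_occ_def by blast
  then obtain n where "\<forall>i\<in>J \<union> K. i < n"
    using finite_nat_set_iff_bounded[of "J \<union> K"] by auto
  then have "J \<in> Pow {..<n}" "K \<in> Pow ({..<n} - J)" using JK(3) by auto
  then show "\<omega> \<in> (\<Union>n. disj_occ_upto n A B)"
    using JK(4) unfolding disj_occ_upto_def by blast
next
  fix \<omega> assume "\<omega> \<in> (\<Union>n. disj_occ_upto n A B)"
  then obtain n J K where n: "J \<subseteq> {..<n}" "K \<subseteq> {..<n} - J" "\<omega> \<in> cyl_core A J \<inter> cyl_core B K"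
    unfolding disj_occ_upto_def by blast
  moreover from n have "finite J" "finite K" by (meson finite_Diff finite_lessThan finite_subset)+
  moreover from n have "J \<inter> K = {}" by auto
  ultimately show "\<omega> \<in> A \<box> B" unfolding disj_occ_def by blast
qed

lemma disj_occ_upto_mono: "m \<le> n \<Longrightarrow> disj_occ_upto m A B \<subseteq> disj_occ_upto n A B"
  unfolding disj_occ_upto_def
  by (intro UN_mono Int_mono Pow_mono Diff_mono order_refl) auto

text \<open>From a countable union of finite unions measurability can be read off; extensional
  \<open>J\<close> make the inner index set finite.\<close>

lemma disj_occ_fam_eq_UN:
  "disj_occ_fam r A = (\<Union>n. \<Union>J\<in>{J \<in> {1..r} \<rightarrow>\<^sub>E Pow {..<n}. disjoint_family_on J {1..r}}.
    \<Inter>i\<in>{1..r}. cyl_core (A i) (J i))"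
proof (intro equalityI subsetI)
  fix \<omega> assume "\<omega> \<in> disj_occ_fam r A"
  then obtain J where J: "\<forall>i\<in>{1..r}. finite (J i)" "disjoint_family_on J {1..r}"
      "\<omega> \<in> (\<Inter>i\<in>{1..r}. cyl_core (A i) (J i))"
    unfolding disj_occ_fam_def by blast
  from J(1) have "finite (\<Union>i\<in>{1..r}. J i)" by auto
  then obtain n where "\<forall>k\<in>(\<Union>i\<in>{1..r}. J i). k < n"
    using finite_nat_set_iff_bounded by auto
  then have "restrict J {1..r} \<in> {1..r} \<rightarrow>\<^sub>E Pow {..<n}" by auto
  moreover have "disjoint_family_on (restrict J {1..r}) {1..r}"
    using J(2) by (auto simp: disjoint_family_on_def)
  moreover have "\<omega> \<in> (\<Inter>i\<in>{1..r}. cyl_core (A i) (restrict J {1..r} i))" using J(3) by auto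
  ultimately show "\<omega> \<in> (\<Union>n. \<Union>J\<in>{J \<in> {1..r} \<rightarrow>\<^sub>E Pow {..<n}. disjoint_family_on J {1..r}}.
    \<Inter>i\<in>{1..r}. cyl_core (A i) (J i))" by blast
next
  fix \<omega> assume "\<omega> \<in> (\<Union>n. \<Union>J\<in>{J \<in> {1..r} \<rightarrow>\<^sub>E Pow {..<n}. disjoint_family_on J {1..r}}.
    \<Inter>i\<in>{1..r}. cyl_core (A i) (J i))"
  then obtain n J where J: "J \<in> {1..r} \<rightarrow>\<^sub>E Pow {..<n}" "disjoint_family_on J {1..r}"
      "\<omega> \<in> (\<Inter>i\<in>{1..r}. cyl_core (A i) (J i))"
    by blast
  moreover have "\<forall>i\<in>{1..r}. finite (J i)"
    using J(1) finite_subset[OF _ finite_lessThan[of n]] by (auto simp: PiE_iff)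
  ultimately show "\<omega> \<in> disj_occ_fam r A" unfolding disj_occ_fam_def by blast
qed

text \<open>The union of the first \<open>r\<close> sets of reasons is itself a reason for the
  disjoint occurrence of the first \<open>r\<close> events, and it avoids the last set. The superset
  \<open>F\<close> leaves room for a Borel hull.\<close>

lemma disj_occ_fam_Suc_subset:
  assumes "disj_occ_fam r A \<subseteq> F"
  shows "disj_occ_fam (Suc r) A \<subseteq> F \<box> A (Suc r)"
proof
  fix \<omega> assume "\<omega> \<in> disj_occ_fam (Suc r) A"
  then obtain J where J: "\<And>i. i \<in> {1..Suc r} \<Longrightarrow> finite (J i)" "disjoint_family_on J {1..Suc r}"
      "\<And>i. i \<in> {1..Suc r} \<Longrightarrow> \<omega> \<in> cyl_core (A i) (J i)"
    unfolding disj_occ_fam_def by blast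
  define K where "K = (\<Union>i\<in>{1..r}. J i)"
  have "Cyl K \<omega> \<subseteq> disj_occ_fam r A"
  proof
    fix z assume z: "z \<in> Cyl K \<omega>"
    have "z \<in> cyl_core (A i) (J i)" if i: "i \<in> {1..r}" for i
    proof -
      have "Cyl (J i) z = Cyl (J i) \<omega>"
        using z i by (auto simp: Cyl_def K_def)
      then show ?thesis using J(3)[of i] i by (auto simp: cyl_core_def)
    qed
    moreover have "disjoint_family_on J {1..r}"
      using J(2) by (rule disjoint_family_on_mono[rotated]) auto
    moreover have "\<forall>i\<in>{1..r}. finite (J i)" using J(1) by auto
    ultimately show "z \<in> disj_occ_fam r A" unfolding disj_occ_fam_def by blast
  qed
  then have "\<omega> \<in> cyl_core F K" using assms by (auto simp: cyl_core_def)
  moreover have "finite K" using J(1) by (auto simp: K_def)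
  moreover have "K \<inter> J (Suc r) = {}"
  proof -
    have "J i \<inter> J (Suc r) = {}" if "i \<in> {1..r}" for i
      using disjoint_family_onD[OF J(2), of i "Suc r"] that by auto
    then show ?thesis unfolding K_def by blast
  qed
  moreover have "finite (J (Suc r))" "\<omega> \<in> cyl_core (A (Suc r)) (J (Suc r))"
    using J(1,3)[of "Suc r"] by auto
  ultimately show "\<omega> \<in> F \<box> A (Suc r)" unfolding disj_occ_def by blast
qed

section \<open>Product measures and averaging over exchanges\<close>

locale real_product =
  fixes \<mu> :: "nat \<Rightarrow> real measure"
  assumes prob: "\<And>i. prob_space (\<mu> i)"
    and sets_\<mu>: "\<And>i. sets (\<mu> i) = sets borel"
begin

abbreviation M :: "(nat \<Rightarrow> real) measure" where "M \<equiv> Pi\<^sub>M UNIV \<mu>"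

abbreviation N :: "(nat \<times> bool \<Rightarrow> real) measure" where "N \<equiv> Pi\<^sub>M UNIV (\<lambda>p. \<mu> (fst p))"

sublocale M: prob_space M by (intro prob_space_PiM prob)

sublocale N: prob_space N by (intro prob_space_PiM prob)

lemma sets_M: "sets M = sets borel"
proof -
  have "sets M = sets (Pi\<^sub>M UNIV (\<lambda>_. borel))" by (intro sets_PiM_cong sets_\<mu> refl)
  then show ?thesis by (simp add: sets_PiM_equal_borel)
qed

lemma space_M: "space M = UNIV"
  using sets_M sets_eq_imp_space_eq[of M borel] by simp

lemma space_N: "space N = UNIV"
  using sets_eq_imp_space_eq[OF sets_\<mu>] by (simp add: space_PiM PiE_UNIV_domain)

lemma measurable_select[measurable]: "select \<alpha> \<in> measurable N M"
  unfolding select_def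
proof (rule measurable_PiM_single')
  fix i
  show "(\<lambda>x. x (i, i \<in> \<alpha>)) \<in> measurable N (\<mu> i)"
    using measurable_component_singleton[of "(i, i \<in> \<alpha>)" UNIV "\<lambda>p. \<mu> (fst p)"] by simp
qed (use sets_eq_imp_space_eq[OF sets_\<mu>] in auto)

text \<open>The index map is injective and preserves the marginals.\<close>

lemma distr_select: "distr N M (select \<alpha>) = M"
  using distr_PiM_reindex[of UNIV "\<lambda>p. \<mu> (fst p)" "\<lambda>i. (i, i \<in> \<alpha>)" UNIV] prob
  by (simp add: inj_on_def select_def[abs_def] restrict_UNIV)

lemma prob_select:
  assumes "A \<in> sets M"
  shows "N.prob (select \<alpha> -` A) = M.prob A"
  using assms measure_distr[OF measurable_select, of A \<alpha>] by (simp add: distr_select space_N)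

text \<open>The two selections read disjoint sets of independent coordinates.\<close>

lemma prob_select_indep:
  assumes A: "A \<in> sets M" and B: "B \<in> sets M"
  shows "N.prob (select \<alpha> -` A \<inter> select (- \<alpha>) -` B) = M.prob A * M.prob B"
proof -
  let ?M' = "\<lambda>p :: nat \<times> bool. \<mu> (fst p)"
  have "N.indep_vars ?M' (\<lambda>p x. x p) UNIV"
  proof (subst N.indep_vars_iff_distr_eq_PiM)
    show "distr N (Pi\<^sub>M UNIV ?M') (\<lambda>x. \<lambda>p\<in>UNIV. x p) = (\<Pi>\<^sub>M p\<in>UNIV. distr N (?M' p) (\<lambda>x. x p))"
      using distr_PiM_component[of UNIV ?M'] prob by (simp add: distr_id2 restrict_UNIV)
  qed auto
  then have ind: "N.indep_var (Pi\<^sub>M C ?M') (\<lambda>x. restrict x C) (Pi\<^sub>M D ?M') (\<lambda>x. restrict x D)"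
    if "C \<inter> D = {}" for C D
    using N.indep_var_restrict[of ?M' "\<lambda>p x. x p" UNIV C D] that by simp
  define C where "C \<beta> = range (\<lambda>i. (i, i \<in> \<beta>))" for \<beta> :: "nat set"
  have meas: "select \<beta> \<in> measurable (Pi\<^sub>M (C \<beta>) ?M') M" for \<beta>
    unfolding select_def
  proof (rule measurable_PiM_single')
    fix i
    show "(\<lambda>x. x (i, i \<in> \<beta>)) \<in> measurable (Pi\<^sub>M (C \<beta>) ?M') (\<mu> i)"
      using measurable_component_singleton[of "(i, i \<in> \<beta>)" "C \<beta>" ?M'] by (simp add: C_def)
  qed (use sets_eq_imp_space_eq[OF sets_\<mu>] in auto)
  have sel: "select \<beta> (restrict x (C \<beta>)) = select \<beta> x" for \<beta> and x :: "nat \<times> bool \<Rightarrow> real"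
    by (auto simp: select_def C_def)
  have "C \<alpha> \<inter> C (- \<alpha>) = {}" by (auto simp: C_def)
  from N.indep_var_compose[OF ind[OF this] meas meas]
  have "N.indep_var M (select \<alpha>) M (select (- \<alpha>))" by (simp add: comp_def sel)
  from N.indep_varD[OF this A B] show ?thesis
    using prob_select[OF A] prob_select[OF B] by (simp add: space_N vimage_Int[symmetric] vimage_def Collect_conj_eq)
qed

text \<open>The disjoint occurrence event is only measurable in the completion, hence the inner
  approximation \<open>L\<close>.\<close>

lemma bkr_upto:
  assumes A: "A \<in> sets M" and B: "B \<in> sets M" and L: "L \<in> sets M" "L \<subseteq> disj_occ_upto n A B"
  shows "M.prob L \<le> M.prob A * M.prob B"
proof -
  let ?I = "Pow {..<n}"
  let ?V = "\<lambda>\<alpha>. select \<alpha> -` L" and ?W = "\<lambda>\<alpha>. select \<alpha> -` A \<inter> select (- \<alpha>) -` B"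
  have sel: "select \<alpha> -` E \<in> sets N" if "E \<in> sets M" for \<alpha> E
    using measurable_sets[OF measurable_select that] by (simp add: space_N)
  have card: "(\<Sum>\<alpha>\<in>?I. indicator (E \<alpha>) x) = real (card {\<alpha> \<in> ?I. x \<in> E \<alpha>})"
    for E :: "nat set \<Rightarrow> (nat \<times> bool \<Rightarrow> real) set" and x
    by (simp add: indicator_def sum.If_cases Int_def)
  have le: "(\<Sum>\<alpha>\<in>?I. indicator (?V \<alpha>) x) \<le> (\<Sum>\<alpha>\<in>?I. indicator (?W \<alpha>) x :: real)" for x
  proof -
    have "card {\<alpha> \<in> ?I. x \<in> ?V \<alpha>} \<le> card {\<alpha> \<in> ?I. select \<alpha> x \<in> disj_occ_upto n A B}"
      using L(2) by (intro card_mono) auto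
    also have "\<dots> \<le> card {\<alpha> \<in> ?I. x \<in> ?W \<alpha>}"
      using card_select_disj_occ_upto[of n x A B] by simp
    finally show ?thesis unfolding card by simp
  qed
  have "(\<Sum>\<alpha>\<in>?I. N.prob (?V \<alpha>)) = N.expectation (\<lambda>x. \<Sum>\<alpha>\<in>?I. indicator (?V \<alpha>) x)"
    using sel L(1) by (subst Bochner_Integration.integral_sum) (auto simp: space_N N.emeasure_eq_measure)
  also have "\<dots> \<le> N.expectation (\<lambda>x. \<Sum>\<alpha>\<in>?I. indicator (?W \<alpha>) x)"
    using sel A B L(1) le
    by (intro integral_mono Bochner_Integration.integrable_sum)
      (auto simp: N.emeasure_eq_measure intro!: integrable_real_indicator)
  also have "\<dots> = (\<Sum>\<alpha>\<in>?I. N.prob (?W \<alpha>))"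
    using sel A B by (subst Bochner_Integration.integral_sum) (auto simp: space_N N.emeasure_eq_measure)
  \<comment> \<open>Each sum has \<open>2 ^ n\<close> equal terms: on the left because every
    selection has law \<open>M\<close>, on the right because the probabilities factor by
    independence.\<close>
  finally have "2 ^ n * M.prob L \<le> 2 ^ n * (M.prob A * M.prob B)"
    using prob_select[OF L(1)] prob_select_indep[OF A B] by (simp add: card_Pow)
  then show ?thesis by simp
qed

lemma cyl_core_sets: "A \<in> sets borel \<Longrightarrow> cyl_core A J \<in> sets (completion M)"
  by (rule cyl_core_in_completion) (use M.finite_measure_axioms sets_M in auto)

lemma disj_occ_upto_sets:
  "A \<in> sets borel \<Longrightarrow> B \<in> sets borel \<Longrightarrow> disj_occ_upto n A B \<in> sets (completion M)"
  unfolding disj_occ_upto_def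
  by (intro sets.finite_UN sets.Int cyl_core_sets finite_Pow_iff[THEN iffD2] finite_Diff finite_lessThan)

lemma disj_occ_sets:
  "A \<in> sets borel \<Longrightarrow> B \<in> sets borel \<Longrightarrow> A \<box> B \<in> sets (completion M)"
  unfolding disj_occ_eq_UN_upto by (intro sets.countable_UN'' disj_occ_upto_sets) auto

lemma disj_occ_fam_sets:
  assumes "\<And>i. i \<in> {1..r} \<Longrightarrow> A i \<in> sets borel"
  shows "disj_occ_fam r A \<in> sets (completion M)"
proof -
  have "UNIV \<in> sets (completion M)" using sets.top[of "completion M"] by (simp add: space_M)
  moreover have "finite ({1..r} \<rightarrow>\<^sub>E Pow {..<n})" for n :: nat by (intro finite_PiE) auto
  ultimately show ?thesis
    unfolding disj_occ_fam_eq_UN using assms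
    by (intro sets.countable_UN'' sets.finite_UN sets.countable_INT'' cyl_core_sets) auto
qed

lemma bkr:
  assumes A: "A \<in> sets borel" and B: "B \<in> sets borel"
  shows "measure (completion M) (A \<box> B) \<le> M.prob A * M.prob B"
proof -
  interpret P: prob_space "completion M" by (rule M.prob_space_completion)
  let ?D = "\<lambda>n. disj_occ_upto n A B"
  have "measure (completion M) (?D n) \<le> M.prob A * M.prob B" for n
  proof -
    have D: "?D n \<in> sets (completion M)" using A B by (rule disj_occ_upto_sets)
    \<comment> \<open>The main part is a Borel subset of the same measure, so the bound for inner
      approximations applies to it.\<close>
    have "M.prob (main_part M (?D n)) \<le> M.prob A * M.prob B"
      using A B main_part_sets[OF D] main_part_null_part_Un[OF D]
      by (intro bkr_upto[where n = n]) (simp_all add: sets_M, blast)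
    then show ?thesis using D by (simp add: measure_def)
  qed
  moreover have "(\<lambda>n. measure (completion M) (?D n)) \<longlonglongrightarrow> measure (completion M) (\<Union>n. ?D n)"
    using A B by (intro P.finite_Lim_measure_incseq)
      (auto simp: disj_occ_upto_sets incseq_def disj_occ_upto_mono)
  ultimately show ?thesis
    unfolding disj_occ_eq_UN_upto by (intro LIMSEQ_le_const2) auto
qed

lemma bkr_fam:
  assumes "\<And>i. i \<in> {1..r} \<Longrightarrow> A i \<in> sets borel"
  shows "measure (completion M) (disj_occ_fam r A) \<le> (\<Prod>i\<in>{1..r}. M.prob (A i))"
  using assms
proof (induction r)
  case 0
  interpret P: prob_space "completion M" by (rule M.prob_space_completion)
  show ?case by simp
next
  case (Suc r)
  interpret P: prob_space "completion M" by (rule M.prob_space_completion)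
  have "disj_occ_fam r A \<in> sets (completion M)" using Suc.prems by (intro disj_occ_fam_sets) auto
  from completion_upper[OF this] obtain F where F: "F \<in> sets M" "disj_occ_fam r A \<subseteq> F"
      "emeasure (completion M) (disj_occ_fam r A) = emeasure M F"
    by blast
  have AS: "A (Suc r) \<in> sets borel" using Suc.prems by auto
  have "measure (completion M) (disj_occ_fam (Suc r) A) \<le> measure (completion M) (F \<box> A (Suc r))"
    using F(1) AS by (intro P.finite_measure_mono disj_occ_fam_Suc_subset F(2) disj_occ_sets)
      (auto simp: sets_M)
  also have "\<dots> \<le> M.prob F * M.prob (A (Suc r))"
    using F(1) AS by (intro bkr) (auto simp: sets_M)
  also have "M.prob F = measure (completion M) (disj_occ_fam r A)"
    using F(3) by (simp add: measure_def)
  also have "\<dots> * M.prob (A (Suc r)) \<le> (\<Prod>i\<in>{1..r}. M.prob (A i)) * M.prob (A (Suc r))"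
    using Suc by (intro mult_right_mono) auto
  also have "\<dots> = (\<Prod>i\<in>{1..Suc r}. M.prob (A i))"
    by (simp add: prod.nat_ivl_Suc')
  finally show ?case .
qed

end

theorem theorem10:
  fixes \<mu> :: "nat \<Rightarrow> real measure" and P :: "(nat \<Rightarrow> real) measure"
  assumes "\<And>i. prob_space (\<mu> i)"
    and "\<And>i. sets (\<mu> i) = sets borel"
    and "P = completion (Pi\<^sub>M UNIV \<mu>)"
  shows "(\<forall>A B :: (nat \<Rightarrow> real) set. A \<in> sets borel \<longrightarrow> B \<in> sets borel \<longrightarrow>
            A \<box> B \<in> sets P \<and> measure P (A \<box> B) \<le> measure P A * measure P B) \<and>
         (\<forall>r \<ge> 2. \<forall>A :: nat \<Rightarrow> (nat \<Rightarrow> real) set. (\<forall>i\<in>{1..r}. A i \<in> sets borel) \<longrightarrow>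
            disj_occ_fam r A \<in> sets P \<and> measure P (disj_occ_fam r A) \<le> (\<Prod>i\<in>{1..r}. measure P (A i)))"
proof -
  interpret real_product \<mu> by (rule real_product.intro) (fact assms)+
  have P: "measure P A = M.prob A" if "A \<in> sets borel" for A
    using that by (simp add: assms(3) sets_M)
  show ?thesis
  proof (intro conjI allI impI)
    fix A B :: "(nat \<Rightarrow> real) set" assume AB: "A \<in> sets borel" "B \<in> sets borel"
    show "A \<box> B \<in> sets P" using AB disj_occ_sets by (simp add: assms(3))
    show "measure P (A \<box> B) \<le> measure P A * measure P B"
      using bkr[OF AB] by (simp add: P AB) (simp add: assms(3))
  next
    fix r and A :: "nat \<Rightarrow> (nat \<Rightarrow> real) set" assume A: "\<forall>i\<in>{1..r}. A i \<in> sets borel"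
    show "disj_occ_fam r A \<in> sets P" using A disj_occ_fam_sets by (simp add: assms(3))
    have "(\<Prod>i\<in>{1..r}. measure P (A i)) = (\<Prod>i\<in>{1..r}. M.prob (A i))"
      using A P by (intro prod.cong) auto
    then show "measure P (disj_occ_fam r A) \<le> (\<Prod>i\<in>{1..r}. measure P (A i))"
      using bkr_fam[of r A] A by (simp add: assms(3))
  qed
qed

end
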